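(* Let $m\ge1$, $\rho>0$, $j\in[m]$ and $y\in\mathbb R^m$. If $$|y_k|\le\rho\qquad\text{for every }k\ge j,$$ then every maximizer over $p\in\Delta_m$ of the dual objective $$\sum_{i=1}^m p_i(y_i-8\rho i)-\frac\rho4\|p\|_2^2$$ is supported on $\{1,\dots,j\}$, and $$h_{m,\rho}(y)=h_{m,\rho}(y_1,\dots,y_j,0,\dots,0).$$ In particular, if $y_j=0$, then $$h_{m,\rho}(y)=h_{m,\rho}(y_1,\dots,y_{j-1},0,\dots,0).$$ Consequently, if $i=i_\rho^+(y)\le m$, then the value $h_{m,\rho}(y)$ is exactly independent of $y_{i+1},\dots,y_m$, in the sense that $h_{m,\rho}(y)=h_{m,\rho}(y_1,\dots,y_i,0,\dots,0)$.
   Context: For $m\ge1$, $\rho>0$ define $g_{m,\rho}(y):=\max_{1\le i\le m}\{y_i-8\rho i\}$ for $y\in\mathbb R^m$, and $h_{m,\rho}(y):=\inf_{z\in\mathbb R^m}\{g_{m,\rho}(z)+\frac1\rho\|z-y\|_2^2\}$. $\Delta_m:=\{p\in\mathbb R_+^m:\sum_{i=1}^m p_i=1\}$ is the simplex; the value $h_{m,\rho}(y)$ equals the maximum over $p\in\Delta_m$ of the dual objective $\sum_i p_i(y_i-8\rho i)-\frac\rho4\|p\|_2^2$. The robust progress index is $i_\rho^+(y):=\min\{i\in[m]:|y_k|\le\rho\text{ for every }k\ge i\}$, with $i_\rho^+(y)=m+1$ if the set is empty. All vectors such as $(y_1,\dots,y_j,0,\dots,0)$ are padded by zeros to length $m$.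 *)

theory Defs
  imports "HOL-Analysis.L2_Norm" "HOL-Library.FuncSet"
begin

text \<open>
  Since the paper uses the order and the numerical value of the coordinate indices, a vector of
  dimension \<open>m\<close> is an extensional function on the index set \<open>{1..m}\<close>.
\<close>

abbreviation rvec :: "nat \<Rightarrow> (nat \<Rightarrow> real) set" where
  "rvec m \<equiv> {1..m} \<rightarrow>\<^sub>E UNIV"

definition g :: "nat \<Rightarrow> real \<Rightarrow> (nat \<Rightarrow> real) \<Rightarrow> real" where
  "g m \<rho> y = (MAX i\<in>{1..m}. y i - 8 * \<rho> * real i)"

definition h :: "nat \<Rightarrow> real \<Rightarrow> (nat \<Rightarrow> real) \<Rightarrow> real" where
  "h m \<rho> y = (INF z\<in>rvec m. g m \<rho> z + 1 / \<rho> * (L2_set (\<lambda>i. z i - y i) {1..m})\<^sup>2)"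

definition prob_simplex :: "nat \<Rightarrow> (nat \<Rightarrow> real) set" where
  "prob_simplex m = {p \<in> rvec m. (\<forall>i\<in>{1..m}. 0 \<le> p i) \<and> (\<Sum>i=1..m. p i) = 1}"

definition dual_objective :: "nat \<Rightarrow> real \<Rightarrow> (nat \<Rightarrow> real) \<Rightarrow> (nat \<Rightarrow> real) \<Rightarrow> real" where
  "dual_objective m \<rho> y p =
     (\<Sum>i=1..m. p i * (y i - 8 * \<rho> * real i)) - \<rho> / 4 * (L2_set p {1..m})\<^sup>2"

definition robust_progress_index :: "nat \<Rightarrow> real \<Rightarrow> (nat \<Rightarrow> real) \<Rightarrow> nat" where
  "robust_progress_index m \<rho> y =
     (let I = {i\<in>{1..m}. \<forall>k\<in>{i..m}. \<bar>y k\<bar> \<le> \<rho>} in if I = {} then m + 1 else Min I)"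

text \<open>The vector \<open>(y\<^sub>1, \<dots>, y\<^sub>j, 0, \<dots>, 0)\<close> of length \<open>m\<close>; for \<open>j = 0\<close> it is the zero vector.\<close>

definition zero_pad :: "nat \<Rightarrow> nat \<Rightarrow> (nat \<Rightarrow> real) \<Rightarrow> (nat \<Rightarrow> real)" where
  "zero_pad m j y = (\<lambda>i\<in>{1..m}. if i \<le> j then y i else 0)"

end

(*
  Write c i = y i - 8 * \<rho> * i.  If |y k| \<le> \<rho> for every k \<ge> j, then c j - c k \<ge> 6 * \<rho> for every k > j.
  In the dual objective, moving mass from k to j gains at least 6 * \<rho> per unit of mass and costs at
  most \<rho> / 2 per unit of mass in the quadratic term, so no maximizer has mass beyond j.  In the
  primal problem, capping y j at level c j - \<rho> / 2 costs no more than any lower cap, and this level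
  still exceeds every c k with k > j, so these coordinates may be left uncapped at no cost.
*)

theory Submission
  imports Defs
begin

section \<open>Coordinate sums and the gap between scores\<close>

lemma L2_set_power2: "(L2_set f A)\<^sup>2 = (\<Sum>i\<in>A. (f i)\<^sup>2)"
  by (simp add: L2_set_def sum_nonneg)

lemma dual_objective_sum:
  "dual_objective m \<rho> y p = (\<Sum>i=1..m. p i * (y i - 8 * \<rho> * real i) - \<rho> / 4 * (p i)\<^sup>2)"
  by (simp add: dual_objective_def L2_set_power2 sum_subtractf sum_distrib_left)

lemma sum_remove2:
  assumes "finite A" "j \<in> A" "k \<in> A" "j \<noteq> k"
  shows "sum f A = f j + f k + sum f (A - {j} - {k})"
  using assms by (simp add: sum.remove[of A j] sum.remove[of "A - {j}" k] add.assoc)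

text \<open>From \<open>j\<close> to \<open>k\<close> the index penalty grows by at least
  \<open>8 * \<rho>\<close>, while \<open>a\<close> and \<open>b\<close> differ by at most
  \<open>2 * \<rho>\<close>.\<close>

lemma score_gap:
  fixes \<rho> :: real
  assumes "\<rho> > 0" "j < k" "\<bar>a\<bar> \<le> \<rho>" "\<bar>b\<bar> \<le> \<rho>"
  shows "b - 8 * \<rho> * real k \<le> a - 8 * \<rho> * real j - 6 * \<rho>"
proof -
  have "\<rho> * (real j + 1) \<le> \<rho> * real k"
    using assms(1,2) by (intro mult_left_mono) auto
  then show ?thesis
    using assms(3,4) by (simp add: algebra_simps)
qed

section \<open>Support of dual maximizers\<close>

lemma prob_simplex_le_1:
  assumes "p \<in> prob_simplex m" "i \<in> {1..m}"
  shows "p i \<le> 1"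
proof -
  have "p i \<le> (\<Sum>i=1..m. p i)"
    using assms by (intro member_le_sum) (auto simp: prob_simplex_def)
  then show ?thesis
    using assms(1) by (simp add: prob_simplex_def)
qed

lemma prob_simplex_move_mass:
  assumes "p \<in> prob_simplex m" "j \<in> {1..m}" "k \<in> {1..m}" "j \<noteq> k"
  shows "p(k := 0, j := p j + p k) \<in> prob_simplex m"
proof -
  let ?q = "p(k := 0, j := p j + p k)"
  have "sum ?q ({1..m} - {j} - {k}) = sum p ({1..m} - {j} - {k})"
    by (intro sum.cong) auto
  then have "sum ?q {1..m} = sum p {1..m}"
    using assms(2-4) by (simp add: sum_remove2[where j = j and k = k])
  then show ?thesis
    using assms by (auto simp: prob_simplex_def PiE_def extensional_def)
qed

text \<open>Only the summands at \<open>j\<close> and \<open>k\<close> change. The squares grow by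
  the cross term \<open>2 * p j * p k\<close>, which the factor \<open>\<rho> / 4\<close> turns into
  the term with \<open>\<rho> / 2\<close>.\<close>

lemma dual_objective_move_mass:
  assumes "j \<in> {1..m}" "k \<in> {1..m}" "j \<noteq> k"
  shows "dual_objective m \<rho> y (p(k := 0, j := p j + p k)) - dual_objective m \<rho> y p
    = p k * ((y j - 8 * \<rho> * real j) - (y k - 8 * \<rho> * real k) - \<rho> / 2 * p j)"
proof -
  let ?q = "p(k := 0, j := p j + p k)"
  let ?F = "\<lambda>p i. p i * (y i - 8 * \<rho> * real i) - \<rho> / 4 * (p i)\<^sup>2"
  have "sum (?F ?q) ({1..m} - {j} - {k}) = sum (?F p) ({1..m} - {j} - {k})"
    by (intro sum.cong) auto
  then have "dual_objective m \<rho> y ?q - dual_objective m \<rho> y p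
      = ?F ?q j + ?F ?q k - (?F p j + ?F p k)"
    unfolding dual_objective_sum using assms
    by (simp only: sum_remove2[OF finite_atLeastAtMost assms])
  also have "\<dots> = p k * ((y j - 8 * \<rho> * real j) - (y k - 8 * \<rho> * real k) - \<rho> / 2 * p j)"
    using assms(3) by (simp add: power2_eq_square field_simps)
  finally show ?thesis .
qed

lemma dual_maximizer_support:
  assumes "\<rho> > 0" "j \<in> {1..m}" "\<forall>k\<in>{j..m}. \<bar>y k\<bar> \<le> \<rho>"
    and max: "is_arg_max (dual_objective m \<rho> y) (\<lambda>p. p \<in> prob_simplex m) p"
  shows "{i\<in>{1..m}. p i \<noteq> 0} \<subseteq> {1..j}"
proof (rule ccontr)
  assume "\<not> ?thesis"
  then obtain k where k: "k \<in> {1..m}" "p k \<noteq> 0" "j < k"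
    by (auto simp: subset_iff not_le)
  have p: "p \<in> prob_simplex m"
    using max by (simp add: is_arg_max_def)
  let ?q = "p(k := 0, j := p j + p k)"
  have "0 < p k"
    using p k by (simp add: prob_simplex_def less_le)
  have "\<rho> / 2 * p j \<le> \<rho> / 2"
    using prob_simplex_le_1[OF p assms(2)] assms(1) by simp
  moreover have "y k - 8 * \<rho> * real k \<le> y j - 8 * \<rho> * real j - 6 * \<rho>"
    using score_gap[OF assms(1) k(3)] assms(2,3) k by auto
  ultimately have "0 < (y j - 8 * \<rho> * real j) - (y k - 8 * \<rho> * real k) - \<rho> / 2 * p j"
    using assms(1) by linarith
  with \<open>0 < p k\<close> have "dual_objective m \<rho> y p < dual_objective m \<rho> y ?q"
    using dual_objective_move_mass[of j m k \<rho> y p] assms(2) k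
    by (metis diff_gt_0_iff_gt less_irrefl zero_less_mult_iff)
  moreover have "?q \<in> prob_simplex m"
    using prob_simplex_move_mass[OF p assms(2)] k by simp
  ultimately show False
    using max by (auto simp: is_arg_max_def)
qed

section \<open>Comparison of primal values\<close>

lemma g_ge: "i \<in> {1..m} \<Longrightarrow> z i - 8 * \<rho> * real i \<le> g m \<rho> z"
  unfolding g_def by (intro Max_ge) auto

lemma g_le:
  assumes "m \<ge> 1" "\<And>i. i \<in> {1..m} \<Longrightarrow> z i - 8 * \<rho> * real i \<le> t"
  shows "g m \<rho> z \<le> t"
  unfolding g_def using assms by (subst Max_le_iff) auto

text \<open>Real infima can be compared only over sets bounded below. Coordinate 1 alone gives a
  bound: with \<open>s = z 1 - y 1\<close>, completing the square shows that
  \<open>s + s\<^sup>2 / \<rho>\<close> is at least \<open>- \<rho> / 4\<close>.\<close>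

lemma bdd_below_h_objective:
  assumes "m \<ge> 1" "\<rho> > 0"
  shows "bdd_below ((\<lambda>z. g m \<rho> z + 1 / \<rho> * (L2_set (\<lambda>i. z i - y i) {1..m})\<^sup>2) ` rvec m)"
proof (rule bdd_belowI2)
  fix z
  have "z 1 - 8 * \<rho> \<le> g m \<rho> z"
    using g_ge[of 1 m z \<rho>] assms(1) by simp
  moreover have "(z 1 - y 1)\<^sup>2 \<le> (\<Sum>i=1..m. (z i - y i)\<^sup>2)"
    using assms(1) by (intro member_le_sum) auto
  then have "1 / \<rho> * (z 1 - y 1)\<^sup>2 \<le> 1 / \<rho> * (L2_set (\<lambda>i. z i - y i) {1..m})\<^sup>2"
    unfolding L2_set_power2 using assms(2) by (intro mult_left_mono) auto
  moreover have "1 / \<rho> * (z 1 - y 1)\<^sup>2 + (z 1 - y 1) + \<rho> / 4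
      = 1 / \<rho> * (z 1 - y 1 + \<rho> / 2)\<^sup>2"
    using assms(2) by (simp add: power2_eq_square field_simps)
  moreover have "0 \<le> 1 / \<rho> * (z 1 - y 1 + \<rho> / 2)\<^sup>2"
    using assms(2) by simp
  ultimately show "y 1 - 8 * \<rho> - \<rho> / 4
      \<le> g m \<rho> z + 1 / \<rho> * (L2_set (\<lambda>i. z i - y i) {1..m})\<^sup>2"
    by linarith
qed

text \<open>
  The competitor \<open>z'\<close> for \<open>y'\<close> leaves the coordinates beyond \<open>j\<close> uncapped and raises \<open>z j\<close>
  to \<open>y j - \<rho> / 2\<close> if the level of \<open>z\<close> was lower than that.
\<close>

lemma h_le_if_eq_upto:
  assumes "\<rho> > 0" "j \<in> {1..m}"
    and eq: "\<And>i. i \<in> {1..j} \<Longrightarrow> y' i = y i"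
    and y': "\<forall>k\<in>{j..m}. \<bar>y' k\<bar> \<le> \<rho>"
  shows "h m \<rho> y' \<le> h m \<rho> y"
  unfolding h_def
proof (rule cINF_mono)
  have m: "m \<ge> 1"
    using assms(2) by simp
  show "rvec m \<noteq> {}"
    by (simp add: PiE_eq_empty_iff)
  show "bdd_below ((\<lambda>z. g m \<rho> z + 1 / \<rho> * (L2_set (\<lambda>i. z i - y' i) {1..m})\<^sup>2) ` rvec m)"
    using m assms(1) by (rule bdd_below_h_objective)
  fix z
  define t where "t = g m \<rho> z"
  \<comment> \<open>\<open>d\<close> is the depth of the level \<open>t\<close> below the score of
    \<open>y j\<close>. Capping coordinate \<open>j\<close> alone at depth \<open>s\<close> saves
    \<open>s\<close> in the maximum and costs \<open>s\<^sup>2 / \<rho>\<close>, so the best depth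
    is \<open>\<rho> / 2\<close>; a level deeper than this is raised to it.\<close>
  define d where "d = y j - 8 * \<rho> * real j - t"
  define a where "a = (if d \<le> \<rho> / 2 then z j else y j - \<rho> / 2)"
  define z' where "z' = (\<lambda>i\<in>{1..m}. if i < j then z i else if i = j then a else y' i)"
  have z_le: "z i - 8 * \<rho> * real i \<le> t" if "i \<in> {1..m}" for i
    unfolding t_def using that by (rule g_ge)
  have yj: "y' j = y j"
    using eq assms(2) by simp
  have g_z': "g m \<rho> z' \<le> max t (y j - 8 * \<rho> * real j - \<rho> / 2)"
  proof (rule g_le[OF m])
    fix i assume i: "i \<in> {1..m}"
    consider "i < j" | "i = j" | "j < i"
      by linarith
    then show "z' i - 8 * \<rho> * real i \<le> max t (y j - 8 * \<rho> * real j - \<rho> / 2)"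
    proof cases
      case 1
      then show ?thesis
        using z_le[OF i] i by (simp add: z'_def)
    next
      case 2
      then show ?thesis
        using z_le[OF i] i by (auto simp: z'_def a_def le_max_iff_disj)
    next
      case 3
      \<comment> \<open>The uncapped score of \<open>y' i\<close> lies \<open>6 * \<rho>\<close>
        below that of \<open>y j\<close>, hence below the second argument of the maximum.\<close>
      have "\<bar>y' j\<bar> \<le> \<rho>" "\<bar>y' i\<bar> \<le> \<rho>"
        using y' 3 i assms(2) by auto
      then have "y' i - 8 * \<rho> * real i \<le> y j - 8 * \<rho> * real j - 6 * \<rho>"
        using score_gap[OF assms(1) 3] yj by metis
      then show ?thesis
        using 3 i assms(1) by (simp add: z'_def)
    qed
  qed
  have aj: "max t (y j - 8 * \<rho> * real j - \<rho> / 2) + 1 / \<rho> * (a - y j)\<^sup>2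
      \<le> t + 1 / \<rho> * (z j - y j)\<^sup>2"
  proof (cases "d \<le> \<rho> / 2")
    case True
    then show ?thesis
      by (simp add: a_def d_def)
  next
    case False
    \<comment> \<open>Since the score of \<open>z j\<close> is at most \<open>t\<close>, the
      distance \<open>y j - z j\<close> is at least \<open>d\<close>, which is positive
      here.\<close>
    have "d\<^sup>2 \<le> (y j - z j)\<^sup>2"
      using False assms(1) z_le[OF assms(2)] by (intro power_mono) (auto simp: d_def)
    then have "1 / \<rho> * d\<^sup>2 \<le> 1 / \<rho> * (z j - y j)\<^sup>2"
      using assms(1) by (intro mult_left_mono) (auto simp: power2_commute)
    \<comment> \<open>The raised level \<open>t + d - \<rho> / 2\<close> with cost
      \<open>\<rho> / 4\<close> totals \<open>t + d - \<rho> / 4\<close>; this square shows that it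
      is at most \<open>t + d\<^sup>2 / \<rho>\<close>.\<close>
    moreover have "1 / \<rho> * d\<^sup>2 - d + \<rho> / 4 = 1 / \<rho> * (d - \<rho> / 2)\<^sup>2"
      using assms(1) by (simp add: power2_eq_square field_simps)
    moreover have "0 \<le> 1 / \<rho> * (d - \<rho> / 2)\<^sup>2"
      using assms(1) by simp
    moreover have "1 / \<rho> * (a - y j)\<^sup>2 = \<rho> / 4"
      using False assms(1) by (simp add: a_def power2_eq_square)
    moreover have "max t (y j - 8 * \<rho> * real j - \<rho> / 2) = t + d - \<rho> / 2"
      using False by (simp add: d_def)
    ultimately show ?thesis
      by linarith
  qed
  \<comment> \<open>Below \<open>j\<close> the summands agree; beyond \<open>j\<close> those on the
    left vanish.\<close>
  have "(\<Sum>i\<in>{1..m} - {j}. (z' i - y' i)\<^sup>2) \<le> (\<Sum>i\<in>{1..m} - {j}. (z i - y i)\<^sup>2)"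
    by (intro sum_mono) (auto simp: z'_def eq)
  then have rest: "1 / \<rho> * (\<Sum>i\<in>{1..m} - {j}. (z' i - y' i)\<^sup>2)
      \<le> 1 / \<rho> * (\<Sum>i\<in>{1..m} - {j}. (z i - y i)\<^sup>2)"
    using assms(1) by (intro mult_left_mono) auto
  have split: "1 / \<rho> * (L2_set f {1..m})\<^sup>2
      = 1 / \<rho> * (f j)\<^sup>2 + 1 / \<rho> * (\<Sum>i\<in>{1..m} - {j}. (f i)\<^sup>2)" for f
    unfolding L2_set_power2 sum.remove[OF finite_atLeastAtMost assms(2)] by (rule distrib_left)
  have "z' j - y' j = a - y j"
    using assms(2) yj by (simp add: z'_def)
  then have "g m \<rho> z' + 1 / \<rho> * (L2_set (\<lambda>i. z' i - y' i) {1..m})\<^sup>2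
      \<le> g m \<rho> z + 1 / \<rho> * (L2_set (\<lambda>i. z i - y i) {1..m})\<^sup>2"
    using g_z' aj rest unfolding split t_def[symmetric] by simp
  moreover have "z' \<in> rvec m"
    by (simp add: z'_def)
  ultimately show "\<exists>z'\<in>rvec m. g m \<rho> z' + 1 / \<rho> * (L2_set (\<lambda>i. z' i - y' i) {1..m})\<^sup>2
      \<le> g m \<rho> z + 1 / \<rho> * (L2_set (\<lambda>i. z i - y i) {1..m})\<^sup>2"
    by blast
qed

text \<open>The comparison \<open>h_le_if_eq_upto\<close> bounds only the vector on its smaller
  side. Both \<open>y\<close> and its truncation satisfy that bound, so it applies in both
  directions.\<close>

lemma h_zero_pad:
  assumes "\<rho> > 0" "j \<in> {1..m}" "\<forall>k\<in>{j..m}. \<bar>y k\<bar> \<le> \<rho>"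
  shows "h m \<rho> y = h m \<rho> (zero_pad m j y)"
proof (rule antisym)
  have eq: "zero_pad m j y i = y i" if "i \<in> {1..j}" for i
    using that assms(2) by (simp add: zero_pad_def)
  show "h m \<rho> y \<le> h m \<rho> (zero_pad m j y)"
    using assms eq by (intro h_le_if_eq_upto) auto
  have "\<forall>k\<in>{j..m}. \<bar>zero_pad m j y k\<bar> \<le> \<rho>"
    using assms by (auto simp: zero_pad_def)
  then show "h m \<rho> (zero_pad m j y) \<le> h m \<rho> y"
    using assms(1,2) eq by (intro h_le_if_eq_upto) auto
qed

section \<open>Truncation before a zero entry, and the progress index\<close>

lemma zero_pad_pred:
  assumes "y j = 0"
  shows "zero_pad m (j - 1) y = zero_pad m j y"
proof -
  \<comment> \<open>For \<open>j = 0\<close> the subtraction on naturals makes the two conditions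
    identical; otherwise they differ only at \<open>i = j\<close>, where \<open>y\<close>
    vanishes.\<close>
  have "(if i \<le> j - 1 then y i else 0) = (if i \<le> j then y i else 0)" for i
    using assms by (cases "i = j") auto
  then show ?thesis
    by (simp add: zero_pad_def)
qed

lemma robust_progress_index_le:
  assumes "robust_progress_index m \<rho> y \<le> m"
  shows "robust_progress_index m \<rho> y \<in> {1..m}"
    and "\<forall>k\<in>{robust_progress_index m \<rho> y..m}. \<bar>y k\<bar> \<le> \<rho>"
proof -
  define I where "I = {i\<in>{1..m}. \<forall>k\<in>{i..m}. \<bar>y k\<bar> \<le> \<rho>}"
  have r: "robust_progress_index m \<rho> y = (if I = {} then m + 1 else Min I)"
    unfolding robust_progress_index_def I_def Let_def ..
  \<comment> \<open>The default value \<open>m + 1\<close> would violate the assumed bound.\<close>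
  have "I \<noteq> {}"
    using assms r by (auto split: if_splits)
  moreover have "finite I"
    by (simp add: I_def)
  ultimately have "robust_progress_index m \<rho> y \<in> I"
    using r by simp
  then show "robust_progress_index m \<rho> y \<in> {1..m}"
    and "\<forall>k\<in>{robust_progress_index m \<rho> y..m}. \<bar>y k\<bar> \<le> \<rho>"
    by (auto simp: I_def)
qed

theorem lemma6p3:
  fixes m :: nat and \<rho> :: real and y :: "nat \<Rightarrow> real"
  assumes "m \<ge> 1" and "\<rho> > 0" and "y \<in> rvec m"
  shows "(\<forall>j\<in>{1..m}. (\<forall>k\<in>{j..m}. \<bar>y k\<bar> \<le> \<rho>) \<longrightarrow>
            (\<forall>p. is_arg_max (dual_objective m \<rho> y) (\<lambda>p. p \<in> prob_simplex m) p \<longrightarrow>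
                 {i\<in>{1..m}. p i \<noteq> 0} \<subseteq> {1..j}) \<and>
            h m \<rho> y = h m \<rho> (zero_pad m j y) \<and>
            (y j = 0 \<longrightarrow> h m \<rho> y = h m \<rho> (zero_pad m (j - 1) y))) \<and>
         (\<forall>i. i = robust_progress_index m \<rho> y \<and> i \<le> m \<longrightarrow>
            h m \<rho> y = h m \<rho> (zero_pad m i y))"
proof (intro conjI ballI allI impI)
  fix j p
  assume "j \<in> {1..m}" "\<forall>k\<in>{j..m}. \<bar>y k\<bar> \<le> \<rho>"
    and "is_arg_max (dual_objective m \<rho> y) (\<lambda>p. p \<in> prob_simplex m) p"
  then show "{i\<in>{1..m}. p i \<noteq> 0} \<subseteq> {1..j}"
    using dual_maximizer_support assms(2) by blast
next
  fix j
  assume "j \<in> {1..m}" "\<forall>k\<in>{j..m}. \<bar>y k\<bar> \<le> \<rho>"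
  then show *: "h m \<rho> y = h m \<rho> (zero_pad m j y)"
    using h_zero_pad assms(2) by blast
  assume "y j = 0"
  then show "h m \<rho> y = h m \<rho> (zero_pad m (j - 1) y)"
    using * by (simp only: zero_pad_pred)
next
  fix i
  assume "i = robust_progress_index m \<rho> y \<and> i \<le> m"
  then show "h m \<rho> y = h m \<rho> (zero_pad m i y)"
    using h_zero_pad assms(2) robust_progress_index_le by blast
qed

end
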